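(* Let $F,H_1,\dots,H_m,G_1,\dots,G_n,F_{i,j}\ (1\le i\le m,1\le j\le n)$ be real symmetric $p\times p$ matrices and define the bilinear matrix-valued function $\mathcal{B}(\mathbf{x},\mathbf{y})=F+\sum_{i=1}^m x_iH_i+\sum_{j=1}^n y_jG_j+\sum_{i=1}^m\sum_{j=1}^n x_iy_jF_{i,j}$ for $\mathbf{x}\in\mathbb{R}^m,\mathbf{y}\in\mathbb{R}^n$. Let $\Gamma=\frac12(F_{i,j})_{i,j}$ be the $mp\times np$ block matrix with $(i,j)$-block $\frac12 F_{i,j}$, $\Omega_1=(H_1\ \cdots\ H_m)$, $\Omega_2=(G_1\ \cdots\ G_n)$, and $M=\begin{pmatrix}0&\Gamma\\\Gamma^{\mathsf T}&0\end{pmatrix}\in\mathcal{S}^{(m+n)p}$. Suppose $M=M_1-M_2$ with $M_1,M_2\succeq0$. Define $\mathcal{B}^+(\mathbf{x},\mathbf{y})=\begin{pmatrix}\mathbf{x}\otimes I\\\mathbf{y}\otimes I\end{pmatrix}^{\mathsf T}M_1\begin{pmatrix}\mathbf{x}\otimes I\\\mathbf{y}\otimes I\end{pmatrix}+(\Omega_1\ \Omega_2)\begin{pmatrix}\mathbf{x}\otimes I\\\mathbf{y}\otimes I\end{pmatrix}+F$ and $\mathcal{B}^-(\mathbf{x},\mathbf{y})=\begin{pmatrix}\mathbf{x}\otimes I\\\mathbf{y}\otimes I\end{pmatrix}^{\mathsf T}M_2\begin{pmatrix}\mathbf{x}\otimes I\\\mathbf{y}\otimes I\end{pmatrix}$,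 where $I$ is the $p\times p$ identity. Then $\mathcal{B}=\mathcal{B}^+-\mathcal{B}^-$, and $\mathcal{B}^+$ and $\mathcal{B}^-$ are PSD-convex on $\mathbb{R}^{m+n}$.
   Context: $\mathcal{S}^p$ denotes the real symmetric $p\times p$ matrices; $A\succeq0$ means positive semidefinite and $A\preceq B$ means $B-A\succeq0$. $\mathbf{x},\mathbf{y}$ are column vectors and $\otimes$ is the Kronecker product, so $\mathbf{x}\otimes I$ is $mp\times p$. A matrix-valued function $\mathcal{G}\colon\mathbb{R}^k\to\mathcal{S}^p$ is PSD-convex on a convex set $\mathcal{C}$ if for all $\mathbf{z}_1,\mathbf{z}_2\in\mathcal{C}$ and $\mu\in(0,1)$, $\mathcal{G}(\mu\mathbf{z}_1+(1-\mu)\mathbf{z}_2)\preceq\mu\mathcal{G}(\mathbf{z}_1)+(1-\mu)\mathcal{G}(\mathbf{z}_2)$. *)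

theory Defs
  imports "HOL-Analysis.Analysis"
begin

text \<open>
  Sizes are index types: \<open>'p\<close> has \<open>p\<close> elements, \<open>'m \<times> 'p\<close> indexes the \<open>mp\<close> rows of an \<open>m\<close>-fold
  column of blocks (block index first), and a sum type indexes the concatenation of two blocks.
\<close>

definition sym_matrix :: "real^'p^'p \<Rightarrow> bool" where
  "sym_matrix A \<longleftrightarrow> transpose A = A"

definition psd :: "real^'p^'p \<Rightarrow> bool" where
  "psd A \<longleftrightarrow> sym_matrix A \<and> (\<forall>v. 0 \<le> v \<bullet> (A *v v))"

definition psd_le :: "real^'p^'p \<Rightarrow> real^'p^'p \<Rightarrow> bool" (infix "\<preceq>" 50) where
  "A \<preceq> B \<longleftrightarrow> psd (B - A)"

text \<open>The second conjunct says that \<open>\<G>\<close> takes its values in the symmetric matrices.\<close>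

definition psd_convex_on :: "(real^'k) set \<Rightarrow> (real^'k \<Rightarrow> real^'p^'p) \<Rightarrow> bool" where
  "psd_convex_on C \<G> \<longleftrightarrow>
     convex C \<and> (\<forall>z. sym_matrix (\<G> z)) \<and>
     (\<forall>z1\<in>C. \<forall>z2\<in>C. \<forall>\<mu>. 0 < \<mu> \<and> \<mu> < 1 \<longrightarrow>
        \<G> (\<mu> *\<^sub>R z1 + (1 - \<mu>) *\<^sub>R z2) \<preceq> \<mu> *\<^sub>R \<G> z1 + (1 - \<mu>) *\<^sub>R \<G> z2)"

definition hstack :: "real^'b^'a \<Rightarrow> real^'c^'a \<Rightarrow> real^('b + 'c)^'a" where
  "hstack A B = (\<chi> i k. case k of Inl j \<Rightarrow> A $ i $ j | Inr j \<Rightarrow> B $ i $ j)"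

definition vstack :: "real^'c^'a \<Rightarrow> real^'c^'b \<Rightarrow> real^'c^('a + 'b)" where
  "vstack A B = (\<chi> k j. case k of Inl i \<Rightarrow> A $ i $ j | Inr i \<Rightarrow> B $ i $ j)"

definition block_row :: "('n::finite \<Rightarrow> real^'q^'p) \<Rightarrow> real^('n \<times> 'q)^'p" where
  "block_row A = (\<chi> k jl. A (fst jl) $ k $ snd jl)"

definition block_matrix :: "('m::finite \<Rightarrow> 'n::finite \<Rightarrow> real^'q^'p) \<Rightarrow> real^('n \<times> 'q)^('m \<times> 'p)" where
  "block_matrix A = (\<chi> ik jl. A (fst ik) (fst jl) $ snd ik $ snd jl)"

text \<open>Kronecker product of a column vector with a matrix; the column index \<open>1 \<times> 'q\<close> is
  identified with \<open>'q\<close>.\<close>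

definition kron_vec :: "real^'m \<Rightarrow> real^'q^'p \<Rightarrow> real^'q^('m \<times> 'p)" where
  "kron_vec x A = (\<chi> ik l. x $ fst ik * A $ snd ik $ l)"

definition bilinear_fun ::
  "real^'p^'p \<Rightarrow> ('m \<Rightarrow> real^'p^'p) \<Rightarrow> ('n \<Rightarrow> real^'p^'p) \<Rightarrow> ('m \<Rightarrow> 'n \<Rightarrow> real^'p^'p)
    \<Rightarrow> real^'m \<Rightarrow> real^'n \<Rightarrow> real^'p^'p" where
  "bilinear_fun F H G K x y =
     F + (\<Sum>i\<in>UNIV. (x $ i) *\<^sub>R H i) + (\<Sum>j\<in>UNIV. (y $ j) *\<^sub>R G j)
       + (\<Sum>i\<in>UNIV. \<Sum>j\<in>UNIV. (x $ i * y $ j) *\<^sub>R K i j)"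

definition Gamma_matrix ::
  "('m::finite \<Rightarrow> 'n::finite \<Rightarrow> real^'p^'p) \<Rightarrow> real^('n \<times> 'p)^('m \<times> 'p)" where
  "Gamma_matrix K = (1/2) *\<^sub>R block_matrix K"

definition M_matrix ::
  "('m::finite \<Rightarrow> 'n::finite \<Rightarrow> real^'p^'p) \<Rightarrow> real^('m \<times> 'p + 'n \<times> 'p)^('m \<times> 'p + 'n \<times> 'p)" where
  "M_matrix K = vstack (hstack 0 (Gamma_matrix K)) (hstack (transpose (Gamma_matrix K)) 0)"

definition xy_kron :: "real^'m \<Rightarrow> real^'n \<Rightarrow> real^'p^('m \<times> 'p + 'n \<times> 'p)" where
  "xy_kron x y = vstack (kron_vec x (mat 1)) (kron_vec y (mat 1))"

definition B_plus ::
  "real^'p^'p \<Rightarrow> ('m \<Rightarrow> real^'p^'p) \<Rightarrow> ('n \<Rightarrow> real^'p^'p)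
    \<Rightarrow> real^('m \<times> 'p + 'n \<times> 'p)^('m \<times> 'p + 'n \<times> 'p)
    \<Rightarrow> real^'m \<Rightarrow> real^'n \<Rightarrow> real^'p^'p" where
  "B_plus F H G M1 x y =
     transpose (xy_kron x y) ** M1 ** xy_kron x y
       + hstack (block_row H) (block_row G) ** xy_kron x y + F"

definition B_minus ::
  "real^('m \<times> 'p + 'n \<times> 'p)^('m \<times> 'p + 'n \<times> 'p) \<Rightarrow> real^'m \<Rightarrow> real^'n \<Rightarrow> real^'p^'p" where
  "B_minus M2 x y = transpose (xy_kron x y) ** M2 ** xy_kron x y"

text \<open>The components \<open>x\<close> and \<open>y\<close> of \<open>z = (x, y)\<close> in \<open>(m + n)\<close>-dimensional space.\<close>

definition x_part :: "real^('m::finite + 'n::finite) \<Rightarrow> real^'m" where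
  "x_part z = (\<chi> i. z $ Inl i)"

definition y_part :: "real^('m::finite + 'n::finite) \<Rightarrow> real^'n" where
  "y_part z = (\<chi> j. z $ Inr j)"

end

theory Submission imports Defs begin

text \<open>
  Let \<open>Z\<close> be the stacked matrix \<open>x \<otimes> I\<close> over \<open>y \<otimes> I\<close>, which is linear in \<open>(x, y)\<close>. The diagonal
  blocks of \<open>M\<close> vanish, so \<open>Z\<^sup>T M Z\<close> is twice the symmetric part of \<open>(x \<otimes> I)\<^sup>T \<Gamma> (y \<otimes> I)\<close>, that
  is, \<open>\<Sum> x\<^sub>i y\<^sub>j F\<^sub>i\<^sub>j\<close>. The convexity defect of a quadratic map \<open>z \<mapsto> b z z\<close> between \<open>u\<close> and \<open>v\<close> is
  \<open>\<mu> (1 - \<mu>) b (u - v) (u - v)\<close>, hence positive semidefinite as soon as all values of the map are.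
\<close>

lemma sum_UNIV_Plus:
  "(\<Sum>k\<in>(UNIV :: ('a::finite + 'b::finite) set). f k)
    = (\<Sum>i\<in>UNIV. f (Inl i)) + (\<Sum>j\<in>UNIV. f (Inr j))"
  by (simp add: UNIV_Plus_UNIV[symmetric] sum.Plus del: UNIV_Plus_UNIV)

lemma sum_UNIV_Times:
  "(\<Sum>k\<in>(UNIV :: ('a::finite \<times> 'b::finite) set). f k) = (\<Sum>i\<in>UNIV. \<Sum>j\<in>UNIV. f (i, j))"
  by (simp add: sum.cartesian_product)

lemma linear_transpose: "linear (transpose :: real^'n^'m \<Rightarrow> real^'m^'n)"
  by (rule linearI) (simp_all add: transpose_def vec_eq_iff)

lemma linear_matrix_mult_right: "linear (\<lambda>X :: real^'k^'n. (A :: real^'n^'m) ** X)"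
  by (rule linearI)
    (simp_all add: matrix_add_ldistrib matrix_scalar_ac scalar_matrix_assoc)

lemma linear_matrix_mult_left: "linear (\<lambda>X :: real^'n^'m. X ** (A :: real^'k^'n))"
  by (rule linearI)
    (simp_all add: vec_eq_iff matrix_matrix_mult_def sum.distrib algebra_simps sum_distrib_left)

lemma bilinear_matrix_mult:
  "bilinear ((**) :: real^'n^'m \<Rightarrow> real^'k^'n \<Rightarrow> real^'k^'m)"
  by (simp add: bilinear_def linear_matrix_mult_right linear_matrix_mult_left)

lemma bilinear_compose:
  assumes "bilinear h" "linear f" "linear g"
  shows "bilinear (\<lambda>x y. h (f x) (g y))"
  using assms linear_compose[of g "h (f _)"] linear_compose[of f "\<lambda>x. h x (g _)"]
  by (simp add: bilinear_def o_def)

lemma bilinear_convexity_defect: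
  assumes "bilinear b"
  shows "\<mu> *\<^sub>R b u u + (1 - \<mu>) *\<^sub>R b v v - b (\<mu> *\<^sub>R u + (1 - \<mu>) *\<^sub>R v) (\<mu> *\<^sub>R u + (1 - \<mu>) *\<^sub>R v)
    = (\<mu> * (1 - \<mu>)) *\<^sub>R b (u - v) (u - v)"
  unfolding bilinear_ladd[OF assms] bilinear_radd[OF assms] bilinear_lsub[OF assms]
    bilinear_rsub[OF assms] bilinear_lmul[OF assms] bilinear_rmul[OF assms]
  by (simp add: algebra_simps)

lemma sym_matrix_0: "sym_matrix 0"
  by (simp add: sym_matrix_def linear_0[OF linear_transpose])

lemma sym_matrix_add: "sym_matrix A \<Longrightarrow> sym_matrix B \<Longrightarrow> sym_matrix (A + B)"
  by (simp add: sym_matrix_def linear_add[OF linear_transpose])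

lemma sym_matrix_scaleR: "sym_matrix A \<Longrightarrow> sym_matrix (c *\<^sub>R A)"
  by (simp add: sym_matrix_def transpose_scalar)

lemma sym_matrix_sum: "(\<And>i. i \<in> S \<Longrightarrow> sym_matrix (f i)) \<Longrightarrow> sym_matrix (\<Sum>i\<in>S. f i)"
  by (simp add: sym_matrix_def linear_sum[OF linear_transpose])

lemma psd_0: "psd 0"
  by (simp add: psd_def sym_matrix_0)

lemma psd_add: "psd A \<Longrightarrow> psd B \<Longrightarrow> psd (A + B)"
  by (simp add: psd_def sym_matrix_add matrix_vector_mult_add_rdistrib inner_add_right)

lemma psd_scaleR: "0 \<le> c \<Longrightarrow> psd A \<Longrightarrow> psd (c *\<^sub>R A)"
  by (simp add: psd_def sym_matrix_scaleR scaleR_matrix_vector_assoc[symmetric])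

lemma psd_congruence:
  assumes "psd M"
  shows "psd (transpose Z ** M ** Z)"
proof -
  have "v \<bullet> ((transpose Z ** M ** Z) *v v) = (Z *v v) \<bullet> (M *v (Z *v v))" for v
  proof -
    have "v \<bullet> ((transpose Z ** M ** Z) *v v) = v \<bullet> (transpose Z *v (M *v (Z *v v)))"
      by (simp only: matrix_vector_mul_assoc matrix_mul_assoc)
    also have "\<dots> = (v v* transpose Z) \<bullet> (M *v (Z *v v))"
      by (simp only: dot_lmul_matrix)
    finally show ?thesis
      by simp
  qed
  moreover have "sym_matrix (transpose Z ** M ** Z)"
    using assms by (simp add: psd_def sym_matrix_def matrix_transpose_mul matrix_mul_assoc)
  ultimately show ?thesis
    using assms by (simp add: psd_def)
qed

lemma psd_convex_onI:
  assumes "convex C" "\<And>z. sym_matrix (f z)"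
    and "\<And>u v \<mu>. \<lbrakk>u \<in> C; v \<in> C; 0 < \<mu>; \<mu> < 1\<rbrakk>
      \<Longrightarrow> psd (\<mu> *\<^sub>R f u + (1 - \<mu>) *\<^sub>R f v - f (\<mu> *\<^sub>R u + (1 - \<mu>) *\<^sub>R v))"
  shows "psd_convex_on C f"
  using assms by (simp add: psd_convex_on_def psd_le_def)

lemma psd_convex_on_add:
  assumes "psd_convex_on C f" "psd_convex_on C g"
  shows "psd_convex_on C (\<lambda>z. f z + g z)"
proof (rule psd_convex_onI)
  fix u v \<mu>
  assume "u \<in> C" "v \<in> C" "0 < \<mu>" "\<mu> < (1::real)"
  let ?defect = "\<lambda>h. \<mu> *\<^sub>R h u + (1 - \<mu>) *\<^sub>R h v - h (\<mu> *\<^sub>R u + (1 - \<mu>) *\<^sub>R v)"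
  have "psd (?defect f + ?defect g)"
    using assms \<open>u \<in> C\<close> \<open>v \<in> C\<close> \<open>0 < \<mu>\<close> \<open>\<mu> < 1\<close>
    by (intro psd_add) (simp_all add: psd_convex_on_def psd_le_def)
  also have "?defect f + ?defect g = ?defect (\<lambda>z. f z + g z)"
    by (simp add: algebra_simps)
  finally show "psd (?defect (\<lambda>z. f z + g z))" .
qed (use assms in \<open>auto simp: psd_convex_on_def intro: sym_matrix_add\<close>)

lemma psd_convex_on_affine:
  assumes "convex C" "linear A" "\<And>z. sym_matrix (A z)" "sym_matrix B"
  shows "psd_convex_on C (\<lambda>z. A z + B)"
proof (rule psd_convex_onI)
  fix u v \<mu>
  have "\<mu> *\<^sub>R (A u + B) + (1 - \<mu>) *\<^sub>R (A v + B) - (A (\<mu> *\<^sub>R u + (1 - \<mu>) *\<^sub>R v) + B) = 0"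
    unfolding linear_add[OF assms(2)] linear_scale[OF assms(2)]
    by (simp add: algebra_simps)
  then show "psd (\<mu> *\<^sub>R (A u + B) + (1 - \<mu>) *\<^sub>R (A v + B) - (A (\<mu> *\<^sub>R u + (1 - \<mu>) *\<^sub>R v) + B))"
    by (simp only: psd_0)
qed (use assms in \<open>auto intro: sym_matrix_add\<close>)

lemma psd_convex_on_quadratic:
  assumes "convex C" "bilinear b" "\<And>z. psd (b z z)"
  shows "psd_convex_on C (\<lambda>z. b z z)"
proof (rule psd_convex_onI)
  show "psd (\<mu> *\<^sub>R b u u + (1 - \<mu>) *\<^sub>R b v v
      - b (\<mu> *\<^sub>R u + (1 - \<mu>) *\<^sub>R v) (\<mu> *\<^sub>R u + (1 - \<mu>) *\<^sub>R v))"
    if "0 < \<mu>" "\<mu> < 1" for u v \<mu>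
    unfolding bilinear_convexity_defect[OF assms(2)] using that assms(3) by (intro psd_scaleR) auto
qed (use assms in \<open>auto simp: psd_def\<close>)

lemma psd_convex_on_congruence:
  assumes "convex C" "linear L" "psd M"
  shows "psd_convex_on C (\<lambda>z. transpose (L z) ** M ** L z)"
proof (rule psd_convex_on_quadratic[where b = "\<lambda>z w. transpose (L z) ** M ** L w"])
  have "linear (\<lambda>z. transpose (L z) ** M)"
    using linear_compose[OF linear_compose[OF assms(2) linear_transpose] linear_matrix_mult_left]
    by (simp add: o_def)
  then show "bilinear (\<lambda>z w. transpose (L z) ** M ** L w)"
    by (rule bilinear_compose[OF bilinear_matrix_mult _ assms(2)])
qed (use assms psd_congruence in auto)

lemma transpose_vstack: "transpose (vstack A B) = hstack (transpose A) (transpose B)"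
  by (auto simp: vec_eq_iff transpose_def vstack_def hstack_def split: sum.split)

lemma vstack_mult: "vstack A B ** X = vstack (A ** X) (B ** X)"
  by (auto simp: vec_eq_iff matrix_matrix_mult_def vstack_def split: sum.split)

lemma hstack_mult_vstack: "hstack A B ** vstack X Y = A ** X + B ** Y"
  by (simp add: vec_eq_iff matrix_matrix_mult_def hstack_def vstack_def sum_UNIV_Plus)

lemma vstack_congruence:
  "transpose (vstack X Y) ** vstack (hstack A B) (hstack C D) ** vstack X Y
    = transpose X ** A ** X + transpose X ** B ** Y + transpose Y ** C ** X + transpose Y ** D ** Y"
  unfolding transpose_vstack matrix_mul_assoc[symmetric]
  by (simp add: vstack_mult hstack_mult_vstack matrix_add_ldistrib)

lemma block_row_mult_kron_vec:
  "block_row A ** kron_vec x B = (\<Sum>i\<in>UNIV. x $ i *\<^sub>R (A i ** B))"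
  by (simp add: vec_eq_iff matrix_matrix_mult_def block_row_def kron_vec_def sum_UNIV_Times
      sum_distrib_left mult.left_commute)

lemma transpose_kron_vec_mult_block_matrix:
  "transpose (kron_vec x A) ** block_matrix K
    = block_row (\<lambda>j. \<Sum>i\<in>UNIV. x $ i *\<^sub>R (transpose A ** K i j))"
  by (simp add: vec_eq_iff matrix_matrix_mult_def transpose_def block_row_def block_matrix_def
      kron_vec_def sum_UNIV_Times sum_distrib_left mult.assoc)

lemma kron_vec_block_matrix_kron_vec:
  "transpose (kron_vec x A) ** block_matrix K ** kron_vec y B
    = (\<Sum>i\<in>UNIV. \<Sum>j\<in>UNIV. (x $ i * y $ j) *\<^sub>R (transpose A ** K i j ** B))"
proof -
  have "transpose (kron_vec x A) ** block_matrix K ** kron_vec y B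
      = (\<Sum>j\<in>UNIV. y $ j *\<^sub>R ((\<Sum>i\<in>UNIV. x $ i *\<^sub>R (transpose A ** K i j)) ** B))"
    by (simp only: transpose_kron_vec_mult_block_matrix block_row_mult_kron_vec)
  also have "\<dots> = (\<Sum>j\<in>UNIV. \<Sum>i\<in>UNIV. (x $ i * y $ j) *\<^sub>R (transpose A ** K i j ** B))"
    by (simp add: linear_sum[OF linear_matrix_mult_left] linear_scale[OF linear_matrix_mult_left]
        scaleR_sum_right mult.commute)
  also have "\<dots> = (\<Sum>i\<in>UNIV. \<Sum>j\<in>UNIV. (x $ i * y $ j) *\<^sub>R (transpose A ** K i j ** B))"
    by (rule sum.swap)
  finally show ?thesis .
qed

lemma hstack_block_row_mult_xy_kron:
  "hstack (block_row H) (block_row G) ** xy_kron x y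
    = (\<Sum>i\<in>UNIV. x $ i *\<^sub>R H i) + (\<Sum>j\<in>UNIV. y $ j *\<^sub>R G j)"
  by (simp add: xy_kron_def hstack_mult_vstack block_row_mult_kron_vec)

lemma M_matrix_congruence_xy_kron:
  assumes "\<And>i j. sym_matrix (K i j)"
  shows "transpose (xy_kron x y) ** M_matrix K ** xy_kron x y
    = (\<Sum>i\<in>UNIV. \<Sum>j\<in>UNIV. (x $ i * y $ j) *\<^sub>R K i j)" (is "_ = ?S")
proof -
  let ?X = "kron_vec x (mat 1)" and ?Y = "kron_vec y (mat 1)"
  have "sym_matrix ?S"
    using assms by (intro sym_matrix_sum sym_matrix_scaleR)
  have upper: "transpose ?X ** Gamma_matrix K ** ?Y = (1/2) *\<^sub>R ?S"
    by (simp add: Gamma_matrix_def matrix_scalar_ac scalar_matrix_assoc[symmetric]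
        kron_vec_block_matrix_kron_vec)
  have "transpose ?Y ** transpose (Gamma_matrix K) ** ?X
      = transpose (transpose ?X ** Gamma_matrix K ** ?Y)"
    by (simp add: matrix_transpose_mul matrix_mul_assoc)
  also have "\<dots> = (1/2) *\<^sub>R transpose ?S"
    by (simp only: upper transpose_scalar)
  also have "transpose ?S = ?S"
    using \<open>sym_matrix ?S\<close> by (simp add: sym_matrix_def)
  finally have lower: "transpose ?Y ** transpose (Gamma_matrix K) ** ?X = (1/2) *\<^sub>R ?S" .
  show ?thesis
    by (simp add: xy_kron_def M_matrix_def vstack_congruence upper lower)
qed

lemma bilinear_fun_eq_B_plus_M_matrix:
  assumes "\<And>i j. sym_matrix (K i j)"
  shows "bilinear_fun F H G K x y = B_plus F H G (M_matrix K) x y"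
  using assms
  by (simp add: bilinear_fun_def B_plus_def M_matrix_congruence_xy_kron
      hstack_block_row_mult_xy_kron)

lemma B_plus_diff: "B_plus F H G (M1 - M2) x y = B_plus F H G M1 x y - B_minus M2 x y"
  by (simp add: B_plus_def B_minus_def bilinear_lsub[OF bilinear_matrix_mult]
      bilinear_rsub[OF bilinear_matrix_mult])

lemma linear_xy_kron:
  "linear (\<lambda>z :: real^('m::finite + 'n::finite).
    xy_kron (x_part z) (y_part z) :: real^'p^('m \<times> 'p + 'n \<times> 'p))"
  by (rule linearI)
    (auto simp: vec_eq_iff xy_kron_def vstack_def kron_vec_def x_part_def y_part_def algebra_simps
      split: sum.split)

lemma psd_convex_on_B_minus:
  assumes "convex C" "psd M"
  shows "psd_convex_on C (\<lambda>z. B_minus M (x_part z) (y_part z))"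
  unfolding B_minus_def using assms by (intro psd_convex_on_congruence linear_xy_kron)

lemma psd_convex_on_B_plus:
  assumes "convex C" "psd M"
    and "sym_matrix F" "\<And>i. sym_matrix (H i)" "\<And>j. sym_matrix (G j)"
  shows "psd_convex_on C (\<lambda>z. B_plus F H G M (x_part z) (y_part z))"
proof -
  let ?A = "\<lambda>z. hstack (block_row H) (block_row G) ** xy_kron (x_part z) (y_part z)"
  have "linear ?A"
    using linear_compose[OF linear_xy_kron linear_matrix_mult_right] by (simp add: o_def)
  moreover have "sym_matrix (?A z)" for z
    unfolding hstack_block_row_mult_xy_kron
    using assms(4,5) by (intro sym_matrix_add sym_matrix_sum sym_matrix_scaleR)
  ultimately have "psd_convex_on C (\<lambda>z. ?A z + F)"
    using assms(1,3) by (intro psd_convex_on_affine)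
  with psd_convex_on_B_minus[OF assms(1,2)]
  have "psd_convex_on C (\<lambda>z. B_minus M (x_part z) (y_part z) + (?A z + F))"
    by (rule psd_convex_on_add)
  then show ?thesis
    by (simp add: B_plus_def B_minus_def add.assoc)
qed

theorem theorem7:
  fixes F :: "real^'p^'p"
    and H :: "'m::finite \<Rightarrow> real^'p^'p"
    and G :: "'n::finite \<Rightarrow> real^'p^'p"
    and K :: "'m \<Rightarrow> 'n \<Rightarrow> real^'p^'p"
    and M1 M2 :: "real^('m \<times> 'p + 'n \<times> 'p)^('m \<times> 'p + 'n \<times> 'p)"
  assumes "sym_matrix F"
    and "\<And>i. sym_matrix (H i)"
    and "\<And>j. sym_matrix (G j)"
    and "\<And>i j. sym_matrix (K i j)"
    and "M_matrix K = M1 - M2"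
    and "psd M1" and "psd M2"
  shows "(\<forall>x y. bilinear_fun F H G K x y = B_plus F H G M1 x y - B_minus M2 x y)
    \<and> psd_convex_on UNIV (\<lambda>z :: real^('m + 'n). B_plus F H G M1 (x_part z) (y_part z))
    \<and> psd_convex_on UNIV (\<lambda>z :: real^('m + 'n). B_minus M2 (x_part z) (y_part z))"
proof (intro conjI allI)
  show "bilinear_fun F H G K x y = B_plus F H G M1 x y - B_minus M2 x y" for x y
    using assms(4,5) by (simp add: bilinear_fun_eq_B_plus_M_matrix B_plus_diff)
  show "psd_convex_on UNIV (\<lambda>z :: real^('m + 'n). B_plus F H G M1 (x_part z) (y_part z))"
    using assms by (intro psd_convex_on_B_plus convex_UNIV)
  show "psd_convex_on UNIV (\<lambda>z :: real^('m + 'n). B_minus M2 (x_part z) (y_part z))"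
    using assms by (intro psd_convex_on_B_minus convex_UNIV)
qed

end
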